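(* Let $T_n$ be the random leaf-labelled binary tree obtained from the terminal tree of the Galton--Watson process with offspring distribution $p_0=p_2=1/2$, conditioned on having $n$ leaves, by labelling its leaves uniformly at random by the elements of $[n]$. For $1\le a\le n$ let $X_{n,a}$ denote the total number of leaf-sets $S\subset[n]$ with $|S|=a$ that induce the same binary tree in two independent copies of $T_n$. Then $$\mathbb E[X_{n,a}]=\binom{n}{a}\bigl[2^{a-1}(2a-3)!!\bigr]^{-1};$$ in particular, $$\mathbb E[X_{n,1}]=n,\qquad \mathbb E[X_{n,2}]=\frac{n(n-1)}{4},\qquad \mathbb E[X_{n,3}]=\frac{n(n-1)(n-2)}{72}.$$ Consequently, if $M_n$ denotes the largest cardinality of a set $S\subset[n]$ inducing the same binary tree in the two independent copies of $T_n$, then $M_n\le(1+o(1))(e/2)n^{1/2}$ with probability tending to $1$; that is, for every $\varepsilon>0$, $\mathbb P\bigl(M_n\le(1+\varepsilon)(e/2)n^{1/2}\bigr)\to1$ as $n\to\infty$.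
   Context: $[n]=\{1,\dots,n\}$; $(2k-1)!!=1\cdot3\cdots(2k-1)$, $(-1)!!=1$. The Galton--Watson process starts with a single progenitor (the root); every individual independently has $j$ children with probability $p_j$, and the children of each individual are ordered. For $p_0=p_2=1/2$ the process terminates almost surely; the terminal tree is the resulting finite rooted tree with ordered children. Conditionally on having $n$ leaves it is uniformly distributed on the $\frac1n\binom{2(n-1)}{n-1}$ rooted binary trees with $n$ leaves in which each of the $n-1$ non-leaf vertices has two ordered children. Trees with leaf labels are regarded up to isomorphism preserving the root, the order of children, and the leaf labels. For nonempty $S\subset[n]$, the tree induced by $S$ in a rooted leaf-labelled tree $T$ is obtained as follows: let $v(S)$ be the lowest common ancestor of the leaves in $S$; take the subtree formed by the paths from $v(S)$ to the leaves in $S$, rooted at $v(S)$ and with the inherited order of children; suppress all its degree-2 vertices other than the root. For a binary $T$ this is a rooted binary tree with ordered children and leaf-set $S$ (a single vertex if $|S|=1$). *)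

theory Defs
  imports "HOL-Probability.Probability"
begin

section \<open>Rooted trees with ordered children and leaf labels\<close>

text \<open>
  Elements of this type are isomorphism classes (preserving root, order of children and leaf
  labels) of finite trees. Unlabelled trees are rendered as \<open>unit otree\<close>. The junk
  value \<open>ONode []\<close> never occurs below: a childless vertex is always a \<open>OLeaf\<close>.
\<close>

datatype 'a otree = OLeaf 'a | ONode "'a otree list"

primrec leaves :: "'a otree \<Rightarrow> 'a list" where
  "leaves (OLeaf x) = [x]"
| "leaves (ONode ts) = concat (map leaves ts)"

text \<open>A vertex is addressed by the list of child positions on the path from the root to it.\<close>

fun subtree_at :: "'a otree \<Rightarrow> nat list \<Rightarrow> 'a otree option" where
  "subtree_at t [] = Some t"
| "subtree_at (OLeaf x) (i # v) = None"
| "subtree_at (ONode ts) (i # v) = (if i < length ts then subtree_at (ts ! i) v else None)"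

section \<open>Induced trees\<close>

text \<open>The deepest vertex that is an ancestor of all leaves in \<open>S\<close>; a vertex counts
  as its own ancestor, so for a singleton this is the leaf itself.\<close>

definition lca :: "'a set \<Rightarrow> 'a otree \<Rightarrow> nat list" where
  "lca S t = (ARG_MAX length v. \<exists>u. subtree_at t v = Some u \<and> S \<subseteq> set (leaves u))"

text \<open>The subtree formed by the paths from the root to the leaves in \<open>S\<close>, provided
  that there is at least one such leaf.\<close>

fun paths_to :: "'a set \<Rightarrow> 'a otree \<Rightarrow> 'a otree" where
  "paths_to S (OLeaf x) = OLeaf x"
| "paths_to S (ONode ts) =
     ONode (map (paths_to S) (filter (\<lambda>t. set (leaves t) \<inter> S \<noteq> {}) ts))"

text \<open>A vertex other than the root has degree 2 iff it has exactly one child.\<close>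

primrec suppress_below :: "'a otree \<Rightarrow> 'a otree" where
  "suppress_below (OLeaf x) = OLeaf x"
| "suppress_below (ONode ts) =
     (case map suppress_below ts of [t] \<Rightarrow> t | ts' \<Rightarrow> ONode ts')"

fun suppress :: "'a otree \<Rightarrow> 'a otree" where
  "suppress (OLeaf x) = OLeaf x"
| "suppress (ONode ts) = ONode (map suppress_below ts)"

definition induced :: "'a set \<Rightarrow> 'a otree \<Rightarrow> 'a otree" where
  "induced S t = suppress (paths_to S (the (subtree_at t (lca S t))))"

section \<open>The Galton--Watson process\<close>

text \<open>
  Individuals are addressed as above: the root is \<open>[]\<close> and the children of
  \<open>v\<close> are \<open>v @ [0], v @ [1], \<dots>\<close>. A sample point assigns to each
  potential individual its number of children, independently with law \<open>p\<close>.
\<close>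

definition gw_space :: "nat pmf \<Rightarrow> (nat list \<Rightarrow> nat) measure" where
  "gw_space p = (\<Pi>\<^sub>M v\<in>UNIV. measure_pmf p)"

text \<open>\<open>gw_subtree \<omega> v t\<close>: the individual \<open>v\<close> has finitely many
  descendants, and their family tree is \<open>t\<close>.\<close>

inductive gw_subtree :: "(nat list \<Rightarrow> nat) \<Rightarrow> nat list \<Rightarrow> unit otree \<Rightarrow> bool"
  for \<omega> :: "nat list \<Rightarrow> nat" where
  childless: "\<omega> v = 0 \<Longrightarrow> gw_subtree \<omega> v (OLeaf ())"
| children: "ts \<noteq> [] \<Longrightarrow> \<omega> v = length ts \<Longrightarrow>
    (\<forall>i<length ts. gw_subtree \<omega> (v @ [i]) (ts ! i)) \<Longrightarrow> gw_subtree \<omega> v (ONode ts)"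

text \<open>Meaningful only if the process terminates, i.e. if such a tree exists.\<close>

definition terminal_tree :: "(nat list \<Rightarrow> nat) \<Rightarrow> unit otree" where
  "terminal_tree \<omega> = (THE t. gw_subtree \<omega> [] t)"

definition terminates_with_leaves :: "nat \<Rightarrow> (nat list \<Rightarrow> nat) set" where
  "terminates_with_leaves n = {\<omega>. \<exists>t. gw_subtree \<omega> [] t \<and> length (leaves t) = n}"

text \<open>Law of the terminal tree conditioned on having \<open>n\<close> leaves
  (\<open>uniform_measure M A\<close> is \<open>M\<close> conditioned on the event \<open>A\<close>).\<close>

definition gw_conditioned :: "nat pmf \<Rightarrow> nat \<Rightarrow> unit otree measure" where
  "gw_conditioned p n =
     distr (uniform_measure (gw_space p) (terminates_with_leaves n)) (count_space UNIV) terminal_tree"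

section \<open>The random leaf-labelled tree and the agreement statistics\<close>

text \<open>Since ordered trees have no nontrivial automorphisms, distinct bijective labellings of
  the leaves of \<open>t\<close> give distinct elements of this set.\<close>

definition labellings :: "nat \<Rightarrow> unit otree \<Rightarrow> nat otree set" where
  "labellings n t =
     {s. map_otree (\<lambda>_. ()) s = t \<and> distinct (leaves s) \<and> set (leaves s) = {1..n}}"

text \<open>The law of $T_n$; the offspring distribution is $p_0 = p_2 = 1/2$.\<close>

definition T_law :: "nat \<Rightarrow> nat otree measure" where
  "T_law n =
     gw_conditioned (pmf_of_set {0, 2}) n \<bind> (\<lambda>t. measure_pmf (pmf_of_set (labellings n t)))"

definition two_copies :: "nat \<Rightarrow> (nat otree \<times> nat otree) measure" where
  "two_copies n = T_law n \<Otimes>\<^sub>M T_law n"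

definition num_agreements :: "nat \<Rightarrow> nat \<Rightarrow> nat otree \<times> nat otree \<Rightarrow> nat" where
  "num_agreements n a = (\<lambda>(t, t'). card {S. S \<subseteq> {1..n} \<and> card S = a \<and> induced S t = induced S t'})"

definition max_agreement :: "nat \<Rightarrow> nat otree \<times> nat otree \<Rightarrow> nat" where
  "max_agreement n =
     (\<lambda>(t, t'). Max {card S |S. S \<noteq> {} \<and> S \<subseteq> {1..n} \<and> induced S t = induced S t'})"

text \<open>\<open>odd_dfact k\<close> is $(2k-1)!!$, with $(-1)!! = 1$.\<close>

definition odd_dfact :: "nat \<Rightarrow> nat" where
  "odd_dfact k = (\<Prod>i=1..k. 2 * i - 1)"

end

theory Submission
  imports Defs
begin

text \<open>
  The law of \<open>T\<^sub>n\<close> is the uniform law on the binary trees with ordered children whose leaves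
  carry the labels \<open>1, \<dots>, n\<close>: a binary tree with \<open>n\<close> leaves has \<open>2 n - 1\<close> vertices, so every such
  shape is produced by the Galton--Watson process with the same probability, and every shape has
  \<open>n!\<close> labellings (\<open>T_law_eq_uniform_tree\<close>).

  The key fact is that uniform laws are consistent: the tree induced by \<open>S\<close> in a uniform tree on
  \<open>A\<close> is uniform on the trees with leaf set \<open>S\<close> (\<open>map_restrict_uniform_tree\<close>). It suffices to
  delete one leaf. A deleted leaf can be re-attached to a tree with \<open>k\<close> leaves in \<open>4 k - 2\<close> ways,
  whatever its shape (\<open>card_graft\<close>), so the deletion map has fibres of equal size. The same
  observation counts the trees: there are \<open>N\<^sub>a = 2 \<sdot> 6 \<cdots> (4 a - 6) = 2\<^bsup>a-1\<^esup> (2 a - 3)!!\<close> trees on \<open>a\<close>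
  labels (\<open>card_binary_trees\<close>).

  Hence in two independent copies a set \<open>S\<close> of size \<open>a\<close> induces the same tree with probability
  \<open>1 / N\<^sub>a\<close>, and linearity of expectation gives the formula for the mean of \<open>X\<^sub>n\<^sub>,\<^sub>a\<close>.
  The bound on the largest agreement is a first moment argument: since \<open>N\<^sub>k = (2 k - 2)! / (k - 1)!\<close>, this
  mean is at most \<open>4 k ((e / 2) \<surd>n / k)\<^bsup>2k\<^esup>\<close> for \<open>a = k\<close> (\<open>expected_agreements_le\<close>), which is
  dominated by the term \<open>4 k (1 + \<epsilon>)\<^bsup>-2k\<^esup>\<close> of a convergent series as soon as
  \<open>k \<ge> (1 + \<epsilon>) (e / 2) \<surd>n\<close>.
\<close>

section \<open>Binary trees\<close>

instance otree :: (countable) countable by countable_datatype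

inductive binary_tree :: "'a otree \<Rightarrow> bool" where
  binary_leaf: "binary_tree (OLeaf x)"
| binary_node: "binary_tree l \<Longrightarrow> binary_tree r \<Longrightarrow> binary_tree (ONode [l, r])"

lemma binary_leaf_iff [simp]: "binary_tree (OLeaf x)"
  by (rule binary_leaf)

lemma binary_node_iff [simp]: "binary_tree (ONode [l, r]) \<longleftrightarrow> binary_tree l \<and> binary_tree r"
  by (auto intro: binary_node elim: binary_tree.cases)

lemma leaves_binary_nonempty: "binary_tree t \<Longrightarrow> leaves t \<noteq> []"
  by (induction rule: binary_tree.induct) auto

section \<open>Induced trees by structural recursion\<close>

text \<open>
  For distinct leaves this is the induced tree: the vertices above the lowest common ancestor have
  exactly one surviving child, so suppressing them has the effect of cutting there. Unlike the
  passage through the lowest common ancestor, this form is structurally recursive.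
\<close>

definition restrict_tree :: "'a set \<Rightarrow> 'a otree \<Rightarrow> 'a otree" where
  "restrict_tree S t = suppress_below (paths_to S t)"

abbreviation meets :: "'a set \<Rightarrow> 'a otree \<Rightarrow> bool" where
  "meets S t \<equiv> set (leaves t) \<inter> S \<noteq> {}"

lemma restrict_tree_leaf [simp]: "restrict_tree S (OLeaf x) = OLeaf x"
  by (simp add: restrict_tree_def)

lemma restrict_tree_node [simp]:
  "restrict_tree S (ONode [l, r]) =
     (if meets S l then if meets S r then ONode [restrict_tree S l, restrict_tree S r]
                        else restrict_tree S l
      else if meets S r then restrict_tree S r else ONode [])"
  by (simp add: restrict_tree_def)

lemma restrict_tree_props:
  assumes "binary_tree t" "meets S t"
  shows "binary_tree (restrict_tree S t) \<and> leaves (restrict_tree S t) = filter (\<lambda>x. x \<in> S) (leaves t)"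
  using assms
proof (induction rule: binary_tree.induct)
  case (binary_node l r)
  have "filter (\<lambda>x. x \<in> S) (leaves u) = []" if "\<not> meets S u" for u :: "'a otree"
    using that by (auto simp: filter_empty_conv)
  with binary_node show ?case by auto
qed auto

lemma restrict_tree_cong:
  assumes "binary_tree t" "set (leaves t) \<inter> S = set (leaves t) \<inter> S'"
  shows "restrict_tree S t = restrict_tree S' t"
  using assms
proof (induction rule: binary_tree.induct)
  case (binary_node l r)
  then have "set (leaves l) \<inter> S = set (leaves l) \<inter> S'" "set (leaves r) \<inter> S = set (leaves r) \<inter> S'"
    by auto
  with binary_node.IH show ?case by simp
qed auto

lemma restrict_tree_all: "binary_tree t \<Longrightarrow> set (leaves t) \<subseteq> S \<Longrightarrow> restrict_tree S t = t"
proof (induction rule: binary_tree.induct)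
  case (binary_node l r)
  then have "meets S l" "meets S r"
    using leaves_binary_nonempty[of l] leaves_binary_nonempty[of r] by (auto simp: neq_Nil_conv)
  with binary_node show ?case by auto
qed auto

text \<open>
  Inducing in two stages is what lets a passage from \<open>A\<close> to \<open>S\<close> be broken up into the
  removal of one leaf at a time.
\<close>

lemma restrict_restrict_tree:
  assumes "binary_tree t" "S \<subseteq> S'" "meets S t"
  shows "restrict_tree S (restrict_tree S' t) = restrict_tree S t"
  using assms
proof (induction rule: binary_tree.induct)
  case (binary_node l r)
  have *: "meets S (restrict_tree S' u) \<longleftrightarrow> meets S u" if "meets S' u" "binary_tree u" for u
    using restrict_tree_props[OF that(2,1)] \<open>S \<subseteq> S'\<close> by auto
  have "meets S' u" if "meets S u" for u
    using that \<open>S \<subseteq> S'\<close> by auto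
  with binary_node * show ?case by auto
qed auto

lemma subtree_at_props:
  "binary_tree t \<Longrightarrow> subtree_at t v = Some u \<Longrightarrow>
     binary_tree u \<and> set (leaves u) \<subseteq> set (leaves t) \<and> length v < size t"
proof (induction arbitrary: v rule: binary_tree.induct)
  case (binary_leaf x)
  then show ?case by (cases v) auto
next
  case (binary_node l r)
  show ?case
  proof (cases v)
    case (Cons i w)
    with binary_node.prems consider "i = 0" "subtree_at l w = Some u" | "i = 1" "subtree_at r w = Some u"
      by (auto split: if_splits simp: less_2_cases_iff less_Suc_eq)
    then show ?thesis
      using binary_node.IH Cons by cases fastforce+
  qed (use binary_node in auto)
qed

text \<open>
  Descending into a subtree that still carries all of \<open>S\<close> loses only branches that contain
  no leaf of \<open>S\<close>, since by distinctness no leaf of \<open>S\<close> has a second occurrence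
  elsewhere.
\<close>

lemma restrict_tree_subtree:
  assumes "binary_tree t" "distinct (leaves t)" "S \<noteq> {}" "subtree_at t v = Some u" "S \<subseteq> set (leaves u)"
  shows "restrict_tree S u = restrict_tree S t"
  using assms
proof (induction arbitrary: v rule: binary_tree.induct)
  case (binary_leaf x)
  then show ?case by (cases v) auto
next
  case (binary_node l r)
  show ?case
  proof (cases v)
    case (Cons i w)
    with binary_node.prems consider "i = 0" "subtree_at l w = Some u" | "i = 1" "subtree_at r w = Some u"
      by (auto split: if_splits simp: less_2_cases_iff less_Suc_eq)
    then show ?thesis
    proof cases
      case 1
      with binary_node have "S \<subseteq> set (leaves l)" using subtree_at_props[OF _ 1(2)] by blast
      with binary_node 1 show ?thesis by auto
    next
      case 2
      with binary_node have "S \<subseteq> set (leaves r)" using subtree_at_props[OF _ 2(2)] by blast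
      with binary_node 2 show ?thesis by auto
    qed
  qed (use binary_node in auto)
qed

lemma subtree_at_append:
  "subtree_at t v = Some u \<Longrightarrow> subtree_at t (v @ w) = subtree_at u w"
  by (induction t v rule: subtree_at.induct) (auto split: if_splits)

text \<open>
  At the lowest common ancestor both children carry leaves of \<open>S\<close>, since otherwise one of the
  children would be a deeper common ancestor. Hence the exemption of the root from suppression
  makes no difference there.
\<close>

lemma induced_eq_restrict_tree:
  assumes t: "binary_tree t" "distinct (leaves t)" and S: "S \<noteq> {}" "S \<subseteq> set (leaves t)"
  shows "induced S t = restrict_tree S t"
proof -
  define covers where "covers = (\<lambda>v. \<exists>u. subtree_at t v = Some u \<and> S \<subseteq> set (leaves u))"
  have lca: "lca S t = (ARG_MAX length v. covers v)"
    by (simp add: lca_def covers_def)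
  have "covers []"
    using S by (simp add: covers_def)
  moreover have "\<forall>v. covers v \<longrightarrow> length v < size t"
    using subtree_at_props[OF t(1)] by (auto simp: covers_def)
  ultimately have "covers (lca S t)" and deepest: "\<And>v. covers v \<Longrightarrow> length v \<le> length (lca S t)"
    unfolding lca using arg_max_nat_lemma[of covers "[]" length "size t"] by auto
  then obtain u where u: "subtree_at t (lca S t) = Some u" "S \<subseteq> set (leaves u)"
    by (auto simp: covers_def)
  have bu: "binary_tree u" using subtree_at_props[OF t(1) u(1)] by blast
  then have "suppress (paths_to S u) = restrict_tree S u"
  proof cases
    case (binary_node l r)
    have "\<not> S \<subseteq> set (leaves c)" if "[l, r] ! i = c" "i < 2" for i c
    proof
      assume "S \<subseteq> set (leaves c)"
      then have "covers (lca S t @ [i])"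
        using that subtree_at_append[OF u(1), of "[i]"] binary_node by (auto simp: covers_def)
      then show False using deepest[of "lca S t @ [i]"] by simp
    qed
    from this[of 0] this[of 1] have "\<not> S \<subseteq> set (leaves l)" "\<not> S \<subseteq> set (leaves r)" by auto
    with u(2) binary_node have "meets S l" "meets S r" by auto
    with binary_node show ?thesis by (simp add: restrict_tree_def)
  qed auto
  with restrict_tree_subtree[OF t S(1) u] show ?thesis
    by (simp add: induced_def u)
qed

section \<open>Grafting a leaf\<close>

definition binary_trees :: "'a set \<Rightarrow> 'a otree set" where
  "binary_trees A = {t. binary_tree t \<and> distinct (leaves t) \<and> set (leaves t) = A}"

text \<open>
  The \<open>4 k - 2\<close> ways to attach a new leaf to a binary tree with \<open>k\<close> leaves: above any
  of its \<open>2 k - 1\<close> vertices, on the left or on the right.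
\<close>

fun graft :: "'a \<Rightarrow> 'a otree \<Rightarrow> 'a otree set" where
  "graft x (ONode [l, r]) =
     {ONode [OLeaf x, ONode [l, r]], ONode [ONode [l, r], OLeaf x]}
     \<union> (\<lambda>l'. ONode [l', r]) ` graft x l \<union> (\<lambda>r'. ONode [l, r']) ` graft x r"
| "graft x t = {ONode [OLeaf x, t], ONode [t, OLeaf x]}"

lemma graft_props:
  assumes "binary_tree t" "s \<in> graft x t"
  shows "binary_tree s \<and> mset (leaves s) = add_mset x (mset (leaves t)) \<and>
     (x \<notin> set (leaves t) \<longrightarrow> restrict_tree (set (leaves t)) s = t)"
  using assms
proof (induction arbitrary: s rule: binary_tree.induct)
  case (binary_node l r)
  let ?S = "set (leaves l) \<union> set (leaves r)"
  have all: "restrict_tree ?S l = l" "restrict_tree ?S r = r"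
    using binary_node.hyps by (auto intro!: restrict_tree_all)
  have ne: "set (leaves l) \<noteq> {}" "set (leaves r) \<noteq> {}"
    using binary_node.hyps leaves_binary_nonempty by auto
  consider "s = ONode [OLeaf x, ONode [l, r]]" | "s = ONode [ONode [l, r], OLeaf x]"
    | l' where "l' \<in> graft x l" "s = ONode [l', r]"
    | r' where "r' \<in> graft x r" "s = ONode [l, r']"
    using binary_node.prems by auto
  then show ?case
  proof cases
    case 3
    note IH = binary_node.IH(1)[OF 3(1)]
    then have L: "set (leaves l') = insert x (set (leaves l))"
      by (metis set_mset_add_mset_insert set_mset_mset)
    show ?thesis
    proof (intro conjI impI)
      assume x: "x \<notin> set (leaves (ONode [l, r]))"
      then have "restrict_tree ?S l' = restrict_tree (set (leaves l)) l'"
        using L IH by (intro restrict_tree_cong) auto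
      with IH x all ne L show "restrict_tree (set (leaves (ONode [l, r]))) s = ONode [l, r]"
        by (auto simp: 3)
    qed (use IH binary_node.hyps in \<open>auto simp: 3\<close>)
  next
    case 4
    note IH = binary_node.IH(2)[OF 4(1)]
    then have R: "set (leaves r') = insert x (set (leaves r))"
      by (metis set_mset_add_mset_insert set_mset_mset)
    show ?thesis
    proof (intro conjI impI)
      assume x: "x \<notin> set (leaves (ONode [l, r]))"
      then have "restrict_tree ?S r' = restrict_tree (set (leaves r)) r'"
        using R IH by (intro restrict_tree_cong) auto
      with IH x all ne R show "restrict_tree (set (leaves (ONode [l, r]))) s = ONode [l, r]"
        by (auto simp: 4)
    qed (use IH binary_node.hyps in \<open>auto simp: 4\<close>)
  qed (use binary_node.hyps all ne in auto)
qed auto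

text \<open>
  Every leaf \<open>x\<close> of a binary tree with at least two leaves hangs beside some subtree, and
  deleting it merges its parent with the root of that subtree; re-attaching \<open>x\<close> there
  recovers the tree.
\<close>

lemma restrict_eq_imp_graft:
  assumes "binary_tree s" "distinct (leaves s)" "x \<in> set (leaves s)" "meets (- {x}) s"
  shows "s \<in> graft x (restrict_tree (- {x}) s)"
  using assms
proof (induction rule: binary_tree.induct)
  case (binary_node l r)
  have leaf: "u = OLeaf x" if "binary_tree u" "\<not> meets (-{x}) u" "distinct (leaves u)" for u
    using that(1)
  proof cases
    case (binary_node a b)
    then show ?thesis using that leaves_binary_nonempty[of a] leaves_binary_nonempty[of b]
      by (cases "leaves a"; cases "leaves b") auto
  qed (use that in auto)
  have all: "restrict_tree (-{x}) u = u" if "binary_tree u" "x \<notin> set (leaves u)" for u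
    using that by (intro restrict_tree_all) auto
  have top: "ONode [OLeaf x, u] \<in> graft x u" "ONode [u, OLeaf x] \<in> graft x u" if "binary_tree u" for u
    using that by (auto elim: binary_tree.cases)
  have m: "meets (-{x}) u" if "binary_tree u" "x \<notin> set (leaves u)" for u
    using that leaves_binary_nonempty[of u] by (cases "leaves u") auto
  show ?case
  proof (cases "x \<in> set (leaves l)")
    case True
    then have r: "x \<notin> set (leaves r)" using binary_node by auto
    show ?thesis
    proof (cases "meets (-{x}) l")
      case False
      with leaf[OF _ False] binary_node r top[of r] all[of r] m[of r] show ?thesis by auto
    next
      case T: True
      with binary_node r True all[of r] m[of r] show ?thesis by auto
    qed
  next
    case False
    then have r: "x \<in> set (leaves r)" using binary_node by auto
    show ?thesis
    proof (cases "meets (-{x}) r")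
      case F: False
      with leaf[OF _ F] binary_node r False top[of l] all[of l] m[of l] show ?thesis by auto
    next
      case T: True
      with binary_node r False all[of l] m[of l] show ?thesis by auto
    qed
  qed
qed auto

text \<open>
  The count does not depend on the shape of \<open>t\<close>, which is why attaching a leaf at a
  uniformly chosen place keeps a uniform tree uniform.
\<close>

lemma card_graft:
  assumes "binary_tree t" "x \<notin> set (leaves t)"
  shows "finite (graft x t) \<and> card (graft x t) = 4 * length (leaves t) - 2"
  using assms
proof (induction rule: binary_tree.induct)
  case (binary_node l r)
  let ?top = "{ONode [OLeaf x, ONode [l, r]], ONode [ONode [l, r], OLeaf x]}"
  let ?left = "(\<lambda>l'. ONode [l', r]) ` graft x l" and ?right = "(\<lambda>r'. ONode [l, r']) ` graft x r"
  have grown: "x \<in> set (leaves u')" if "u' \<in> graft x u" "binary_tree u" for u u'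
    using graft_props[OF that(2,1)] by (metis set_mset_mset union_single_eq_member)
  have "size l < size (ONode [l, r])" "size r < size (ONode [l, r])"
    by simp_all
  then have acyclic: "l \<noteq> ONode [l, r]" "r \<noteq> ONode [l, r]"
    by (metis less_irrefl)+
  have d: "?top \<inter> ?left = {}" "(?top \<union> ?left) \<inter> ?right = {}"
    using binary_node acyclic by (auto dest: grown)
  have fin: "finite (graft x l)" "finite (graft x r)"
    and c: "card ?left = 4 * length (leaves l) - 2" "card ?right = 4 * length (leaves r) - 2"
    using binary_node by (auto simp: card_image inj_on_def)
  have "card (graft x (ONode [l, r])) = card ?top + card ?left + card ?right"
    using d fin by (simp add: card_Un_disjoint del: insert_disjoint Un_insert_left)
  also have "\<dots> = 2 + (4 * length (leaves l) - 2) + (4 * length (leaves r) - 2)"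
    by (simp add: c)
  also have "\<dots> = 4 * length (leaves (ONode [l, r])) - 2"
    using leaves_binary_nonempty[OF binary_node.hyps(1)] leaves_binary_nonempty[OF binary_node.hyps(2)]
    by (cases "leaves l"; cases "leaves r") auto
  finally show ?case using fin by simp
qed auto

text \<open>
  Together with \<open>restrict_tree_graft\<close> this says that the trees on \<open>insert x A\<close> are
  partitioned into grafting classes, one for each tree on \<open>A\<close>: the classes are the fibres of
  deleting \<open>x\<close>.
\<close>

lemma binary_trees_insert:
  assumes "x \<notin> A" "A \<noteq> {}"
  shows "binary_trees (insert x A) = (\<Union>t\<in>binary_trees A. graft x t)"
proof (intro equalityI subsetI)
  fix s assume "s \<in> binary_trees (insert x A)"
  then have s: "binary_tree s" "distinct (leaves s)" "set (leaves s) = insert x A"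
    by (auto simp: binary_trees_def)
  with assms have m: "meets (- {x}) s" by auto
  from restrict_tree_props[OF s(1) m] s assms
  have "restrict_tree (- {x}) s \<in> binary_trees A"
    by (auto simp: binary_trees_def)
  with restrict_eq_imp_graft[OF s(1,2) _ m] s show "s \<in> (\<Union>t\<in>binary_trees A. graft x t)"
    by auto
next
  fix s assume "s \<in> (\<Union>t\<in>binary_trees A. graft x t)"
  then obtain t where t: "binary_tree t" "distinct (leaves t)" "set (leaves t) = A" "s \<in> graft x t"
    by (auto simp: binary_trees_def)
  from graft_props[OF t(1,4)] have "binary_tree s" "mset (leaves s) = mset (x # leaves t)" by auto
  with mset_eq_imp_distinct_iff[OF this(2)] mset_eq_setD[OF this(2)] t assms
  show "s \<in> binary_trees (insert x A)" by (auto simp: binary_trees_def)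
qed

lemma restrict_tree_graft:
  assumes "t \<in> binary_trees A" "x \<notin> A" "s \<in> graft x t"
  shows "restrict_tree A s = t"
  using graft_props[of t s x] assms by (auto simp: binary_trees_def)

lemma disjoint_grafts:
  "x \<notin> A \<Longrightarrow> disjoint_family_on (graft x) (binary_trees A)"
  by (force simp: disjoint_family_on_def dest: restrict_tree_graft)

lemma card_graft_binary_trees:
  assumes "t \<in> binary_trees A" "x \<notin> A"
  shows "finite (graft x t)" "card (graft x t) = 4 * card A - 2"
  using card_graft[of t x] assms by (auto simp: binary_trees_def distinct_card)

lemma binary_trees_singleton: "binary_trees {x} = {OLeaf x}"
proof -
  have "t = OLeaf x" if "binary_tree t" "distinct (leaves t)" "set (leaves t) = {x}" for t
    using that(1)
  proof cases
    case (binary_node l r)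
    have "length (leaves t) = 1"
      using distinct_card[OF that(2)] that(3) by simp
    then show ?thesis
      using binary_node leaves_binary_nonempty[of l] leaves_binary_nonempty[of r]
      by (simp add: add_is_1)
  qed (use that in auto)
  then show ?thesis by (auto simp: binary_trees_def)
qed

definition num_binary_trees :: "nat \<Rightarrow> nat" where
  "num_binary_trees a = 2 ^ (a - 1) * odd_dfact (a - 1)"

text \<open>
  The factor is the number of ways to attach a further leaf.
\<close>

lemma num_binary_trees_Suc:
  "1 \<le> a \<Longrightarrow> num_binary_trees (Suc a) = (4 * a - 2) * num_binary_trees a"
  by (cases a) (simp_all add: num_binary_trees_def odd_dfact_def algebra_simps)

lemma num_binary_trees_pos: "num_binary_trees a > 0"
  by (auto simp: num_binary_trees_def odd_dfact_def)

lemma card_binary_trees: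
  assumes "finite A" "A \<noteq> {}"
  shows "finite (binary_trees A) \<and> card (binary_trees A) = num_binary_trees (card A)"
  using assms
proof (induction rule: finite_ne_induct)
  case (singleton x)
  show ?case by (simp add: binary_trees_singleton num_binary_trees_def odd_dfact_def)
next
  case (insert x A)
  note graft = card_graft_binary_trees[OF _ insert.hyps(3)]
  have "card (binary_trees (insert x A)) = (\<Sum>t\<in>binary_trees A. card (graft x t))"
    unfolding binary_trees_insert[OF insert.hyps(3,2)]
    using insert.IH graft disjoint_grafts[OF insert.hyps(3)]
    by (intro card_UN_disjoint) (auto simp: disjoint_family_on_def)
  also have "\<dots> = (4 * card A - 2) * num_binary_trees (card A)"
    using insert.IH graft by simp
  also have "\<dots> = num_binary_trees (card (insert x A))"
    using insert.hyps num_binary_trees_Suc[of "card A"] by (simp add: Suc_le_eq card_gt_0_iff)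
  finally show ?case
    unfolding binary_trees_insert[OF insert.hyps(3,2)] using insert.IH graft by auto
qed

lemma binary_trees_finite_nonempty:
  assumes "finite A" "A \<noteq> {}"
  shows "finite (binary_trees A)" "binary_trees A \<noteq> {}"
  using card_binary_trees[OF assms] num_binary_trees_pos[of "card A"] by auto

section \<open>Consistency of the uniform laws\<close>

definition uniform_tree :: "'a set \<Rightarrow> 'a otree pmf" where
  "uniform_tree A = pmf_of_set (binary_trees A)"

text \<open>
  The grafting classes are disjoint and equally large, so a uniform choice from their union is a
  uniform choice of the class followed by a uniform choice inside it.
\<close>

lemma uniform_tree_insert:
  assumes "finite A" "A \<noteq> {}" "x \<notin> A"
  shows "uniform_tree (insert x A) = uniform_tree A \<bind> (\<lambda>t. pmf_of_set (graft x t))"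
proof -
  have ne: "graft x t \<noteq> {}" for t by (induction x t rule: graft.induct) auto
  show ?thesis
    unfolding uniform_tree_def binary_trees_insert[OF assms(3,2)]
    using binary_trees_finite_nonempty[OF assms(1,2)] card_graft_binary_trees[OF _ assms(3)]
      disjoint_grafts[OF assms(3)] ne
    by (intro pmf_of_set_UN[where n = "4 * card A - 2"]) auto
qed

lemma set_pmf_uniform_tree:
  assumes "finite A" "A \<noteq> {}"
  shows "set_pmf (uniform_tree A) = binary_trees A"
  using binary_trees_finite_nonempty[OF assms] by (simp add: uniform_tree_def set_pmf_of_set)

text \<open>
  Consistency of the uniform laws. The leaves outside \<open>S\<close> are removed one at a time: a uniform
  tree on \<open>insert x B\<close> is a uniform tree on \<open>B\<close> with \<open>x\<close> grafted on, and the
  graft is invisible to the tree induced by \<open>S\<close>.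
\<close>

lemma map_restrict_uniform_tree:
  assumes "finite A" "S \<subseteq> A" "S \<noteq> {}"
  shows "map_pmf (restrict_tree S) (uniform_tree A) = uniform_tree S"
proof -
  have "finite (A - S)" using assms by simp
  then show ?thesis using assms
  proof (induction "A - S" arbitrary: A rule: finite_induct)
    case empty
    then have "A = S" by auto
    with empty have "restrict_tree S t = t" if "t \<in> set_pmf (uniform_tree S)" for t
      using that by (auto simp: set_pmf_uniform_tree binary_trees_def intro: restrict_tree_all)
    then show ?case unfolding \<open>A = S\<close> by (simp cong: map_pmf_cong)
  next
    case (insert x F)
    define B where "B = A - {x}"
    have B: "finite B" "S \<subseteq> B" "B \<noteq> {}" "x \<notin> B" "A = Set.insert x B" "F = B - S"
      using insert.prems insert.hyps by (auto simp: B_def)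
    have "map_pmf (restrict_tree S) (pmf_of_set (graft x t)) = return_pmf (restrict_tree S t)"
      if t: "t \<in> binary_trees B" for t
    proof -
      note g = card_graft_binary_trees[OF t B(4)]
      have "graft x t \<noteq> {}" by (induction x t rule: graft.induct) auto
      moreover have "restrict_tree S s = restrict_tree S t" if s: "s \<in> graft x t" for s
      proof -
        have "s \<in> binary_trees (Set.insert x B)"
          unfolding binary_trees_insert[OF B(4,3)] using s t by blast
        then have "restrict_tree S (restrict_tree B s) = restrict_tree S s"
          using B insert.prems by (intro restrict_restrict_tree) (auto simp: binary_trees_def)
        then show ?thesis using restrict_tree_graft[OF t B(4) s] by simp
      qed
      ultimately have "map_pmf (restrict_tree S) (pmf_of_set (graft x t))
          = map_pmf (\<lambda>_. restrict_tree S t) (pmf_of_set (graft x t))"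
        using g by (intro map_pmf_cong) auto
      then show ?thesis by simp
    qed
    then have "map_pmf (restrict_tree S) (uniform_tree A)
        = uniform_tree B \<bind> (\<lambda>t. return_pmf (restrict_tree S t))"
      unfolding B(5) uniform_tree_insert[OF B(1,3,4)] map_bind_pmf
      using B by (intro bind_pmf_cong) (auto simp: set_pmf_uniform_tree)
    also have "\<dots> = map_pmf (restrict_tree S) (uniform_tree B)"
      by (simp add: map_pmf_def)
    also have "\<dots> = uniform_tree S"
      using B insert.prems by (intro insert.hyps) auto
    finally show ?case .
  qed
qed

section \<open>The law of the conditioned Galton--Watson tree\<close>

lemma gw_subtree_unique: "gw_subtree \<omega> v t \<Longrightarrow> gw_subtree \<omega> v t' \<Longrightarrow> t = t'"
proof (induction arbitrary: t' rule: gw_subtree.induct)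
  case (childless v)
  then show ?case by (auto elim: gw_subtree.cases)
next
  case (children ts v)
  from children.prems show ?case
  proof cases
    case (children ts')
    with \<open>\<omega> v = length ts\<close> children.IH show ?thesis by (auto intro: nth_equalityI)
  qed (use children.hyps in auto)
qed

lemma terminal_tree_eq: "gw_subtree \<omega> [] t \<Longrightarrow> terminal_tree \<omega> = t"
  unfolding terminal_tree_def by (blast intro: gw_subtree_unique)

lemma gw_subtree_leaf: "gw_subtree \<omega> v (OLeaf ()) \<longleftrightarrow> \<omega> v = 0"
  by (auto intro: childless elim: gw_subtree.cases)

lemma gw_subtree_node:
  "gw_subtree \<omega> v (ONode ts) \<longleftrightarrow>
     ts \<noteq> [] \<and> \<omega> v = length ts \<and> (\<forall>i<length ts. gw_subtree \<omega> (v @ [i]) (ts ! i))"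
  by (subst gw_subtree.simps) auto

lemma gw_subtree_binary_node:
  "gw_subtree \<omega> v (ONode [l, r]) \<longleftrightarrow>
     \<omega> v = 2 \<and> gw_subtree \<omega> (v @ [0]) l \<and> gw_subtree \<omega> (v @ [1]) r"
  by (auto simp: gw_subtree_node less_Suc_eq numeral_2_eq_2)

lemma gw_subtree_imp_binary:
  "gw_subtree \<omega> v t \<Longrightarrow> (\<And>w. \<omega> w = 0 \<or> \<omega> w = 2) \<Longrightarrow> binary_tree t"
proof (induction rule: gw_subtree.induct)
  case (children ts v)
  then have "length ts = 2" by (metis length_0_conv)
  then obtain l r where ts: "ts = [l, r]" by (auto simp: length_Suc_conv numeral_2_eq_2)
  show ?case using children.IH children.prems unfolding ts by (auto simp: less_Suc_eq)
qed auto

text \<open>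
  That a given binary tree is the family tree of the root constrains the offspring numbers at the
  finitely many addresses of its vertices and nowhere else, so its probability is a product over
  these addresses.
\<close>

definition vertices :: "'a otree \<Rightarrow> nat list set" where
  "vertices t = {v. subtree_at t v \<noteq> None}"

definition out_degree :: "'a otree \<Rightarrow> nat list \<Rightarrow> nat" where
  "out_degree t v = (case the (subtree_at t v) of OLeaf x \<Rightarrow> 0 | ONode ts \<Rightarrow> length ts)"

lemma vertices_leaf: "vertices (OLeaf x) = {[]}"
proof -
  have "subtree_at (OLeaf x) v = None" if "v \<noteq> []" for v
    using that by (cases v) auto
  then show ?thesis by (fastforce simp: vertices_def)
qed

lemma vertices_node: "vertices (ONode [l, r]) = {[]} \<union> (#) 0 ` vertices l \<union> (#) 1 ` vertices r"
proof -
  have "v \<in> vertices (ONode [l, r]) \<longleftrightarrow> v \<in> {[]} \<union> (#) 0 ` vertices l \<union> (#) 1 ` vertices r" for v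
    by (cases v) (auto simp: vertices_def less_Suc_eq split: if_splits)
  then show ?thesis by blast
qed

lemma card_vertices:
  "binary_tree t \<Longrightarrow> finite (vertices t) \<and> card (vertices t) = 2 * length (leaves t) - 1"
proof (induction rule: binary_tree.induct)
  case (binary_node l r)
  have "card (vertices (ONode [l, r])) = 1 + card (vertices l) + card (vertices r)"
    unfolding vertices_node using binary_node.IH
    by (subst card_Un_disjoint, force, force, force, subst card_Un_disjoint) (auto simp: card_image)
  with binary_node leaves_binary_nonempty[of l] leaves_binary_nonempty[of r] show ?case
    by (cases "leaves l"; cases "leaves r") (auto simp: vertices_node)
qed (auto simp: vertices_leaf)

lemma gw_subtree_iff_out_degree:
  "binary_tree t \<Longrightarrow> gw_subtree \<omega> v t \<longleftrightarrow> (\<forall>w\<in>vertices t. \<omega> (v @ w) = out_degree t w)"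
proof (induction arbitrary: v rule: binary_tree.induct)
  case (binary_leaf x)
  then show ?case by (simp add: gw_subtree_leaf vertices_leaf out_degree_def)
next
  case (binary_node l r)
  have "out_degree (ONode [l, r]) (0 # w) = out_degree l w"
    "out_degree (ONode [l, r]) (Suc 0 # w) = out_degree r w"
    "out_degree (ONode [l, r]) [] = 2" for w
    by (simp_all add: out_degree_def)
  then show ?case
    unfolding gw_subtree_binary_node binary_node.IH by (auto simp: vertices_node)
qed

lemma out_degree_binary:
  assumes "binary_tree t" "v \<in> vertices t"
  shows "out_degree t v = 0 \<or> out_degree t v = 2"
proof -
  from assms(2) obtain u where u: "subtree_at t v = Some u" by (auto simp: vertices_def)
  with subtree_at_props[OF assms(1) u] show ?thesis
    by (auto simp: out_degree_def elim: binary_tree.cases)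
qed

abbreviation binary_offspring :: "nat pmf" where
  "binary_offspring \<equiv> pmf_of_set {0, 2}"

lemma space_gw_space [simp]: "space (gw_space p) = UNIV"
  by (simp add: gw_space_def space_PiM)

lemma measurable_offspring [measurable]: "(\<lambda>\<omega>. \<omega> v) \<in> measurable (gw_space p) (count_space UNIV)"
  unfolding gw_space_def
  using measurable_component_singleton[of v UNIV "\<lambda>_. measure_pmf p"]
  by (simp cong: measurable_cong_sets)

lemma measurable_gw_subtree [measurable]:
  "Measurable.pred (gw_space p) (\<lambda>\<omega>. gw_subtree \<omega> v t)"
proof (induction t arbitrary: v)
  case (OLeaf x)
  show ?case by (simp add: gw_subtree_leaf)
next
  case (ONode ts)
  have [measurable]: "Measurable.pred (gw_space p) (\<lambda>\<omega>. gw_subtree \<omega> (v @ [i]) (ts ! i))"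
    if "i \<in> {..<length ts}" for i
    using that by (intro ONode.IH) auto
  have "Measurable.pred (gw_space p)
     (\<lambda>\<omega>. ts \<noteq> [] \<and> \<omega> v = length ts \<and> (\<forall>i\<in>{..<length ts}. gw_subtree \<omega> (v @ [i]) (ts ! i)))"
    by measurable
  then show ?case by (simp add: gw_subtree_node)
qed

lemma sets_gw_subtree: "{\<omega>. gw_subtree \<omega> v t} \<in> sets (gw_space p)"
  using measurable_gw_subtree[where p = p and v = v and t = t] by (simp add: pred_def)

lemma sets_terminates_with_leaves: "terminates_with_leaves n \<in> sets (gw_space p)"
proof -
  have "Measurable.pred (gw_space p) (\<lambda>\<omega>. \<exists>t. gw_subtree \<omega> [] t \<and> length (leaves t) = n)"
    by measurable
  then show ?thesis by (simp add: terminates_with_leaves_def pred_def)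
qed

text \<open>
  On the event of non-termination \<open>terminal_tree\<close> is a description satisfied by nothing, hence
  a single fixed junk tree; so that event contributes to one fibre only.
\<close>

lemma measurable_terminal_tree: "terminal_tree \<in> measurable (gw_space p) (count_space UNIV)"
proof (subst measurable_count_space_eq2_countable, intro conjI ballI)
  fix t :: "unit otree"
  \<comment> \<open>the common value of \<open>terminal_tree\<close> at all non-terminating sample points\<close>
  define junk where "junk = (THE t :: unit otree. False)"
  have junk: "terminal_tree \<omega> = junk" if "\<forall>t. \<not> gw_subtree \<omega> [] t" for \<omega>
    using that by (simp add: terminal_tree_def junk_def)
  have "terminal_tree -` {t} \<inter> space (gw_space p)
      = {\<omega>. gw_subtree \<omega> [] t} \<union> {\<omega>. (\<forall>t. \<not> gw_subtree \<omega> [] t) \<and> t = junk}"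
    using junk by (auto dest: terminal_tree_eq)
  moreover have "Measurable.pred (gw_space p) (\<lambda>\<omega>. (\<forall>t. \<not> gw_subtree \<omega> [] t) \<and> t = junk)"
    by measurable
  ultimately show "terminal_tree -` {t} \<inter> space (gw_space p) \<in> sets (gw_space p)"
    using sets_gw_subtree[where p = p and v = "[]" and t = t] by (simp add: pred_def sets.Un)
qed auto

text \<open>
  A binary tree with \<open>n\<close> leaves has \<open>2 n - 1\<close> vertices, and each of them has its
  prescribed number of children with probability \<open>1/2\<close>. The value depends on \<open>n\<close> only,
  which makes the conditioned law uniform.
\<close>

lemma emeasure_gw_subtree:
  assumes "binary_tree t"
  shows "emeasure (gw_space binary_offspring) {\<omega>. gw_subtree \<omega> [] t}
       = ennreal ((1 / 2) ^ (2 * length (leaves t) - 1))"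
proof -
  let ?M = "\<lambda>_ :: nat list. measure_pmf binary_offspring"
  have "{\<omega>. gw_subtree \<omega> [] t} = prod_emb UNIV ?M (vertices t) (Pi\<^sub>E (vertices t) (\<lambda>w. {out_degree t w}))"
    using gw_subtree_iff_out_degree[OF assms, of _ "[]"]
    by (auto simp: prod_emb_def PiE_iff space_PiM)
  then have "emeasure (gw_space binary_offspring) {\<omega>. gw_subtree \<omega> [] t}
      = (\<Prod>w\<in>vertices t. emeasure (measure_pmf binary_offspring) {out_degree t w})"
    unfolding gw_space_def using card_vertices[OF assms]
    by (simp add: emeasure_PiM_emb measure_pmf.prob_space_axioms)
  also have "\<dots> = (\<Prod>w\<in>vertices t. ennreal (1 / 2))"
    using out_degree_binary[OF assms]
    by (intro prod.cong refl) (fastforce simp: emeasure_pmf_single pmf_of_set)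
  finally show ?thesis
    using card_vertices[OF assms] by (simp only: prod_constant ennreal_power)
qed

lemma AE_binary_offspring: "AE \<omega> in gw_space binary_offspring. \<forall>v. \<omega> v = 0 \<or> \<omega> v = 2"
proof (subst AE_all_countable, rule allI)
  fix v :: "nat list"
  have "AE k in measure_pmf binary_offspring. k = 0 \<or> k = 2"
    by (auto simp: AE_measure_pmf_iff set_pmf_of_set)
  then show "AE \<omega> in gw_space binary_offspring. \<omega> v = 0 \<or> \<omega> v = 2"
    unfolding gw_space_def by (intro AE_PiM_component measure_pmf.prob_space_axioms) auto
qed

section \<open>Conditioning on the number of leaves and labelling\<close>

definition shapes :: "nat \<Rightarrow> unit otree set" where
  "shapes n = {t. binary_tree t \<and> length (leaves t) = n}"

lemma leaves_map_otree: "leaves (map_otree f t) = map f (leaves t)"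
  by (induction t) (simp_all add: map_concat o_def cong: map_cong)

lemma binary_tree_map_otree: "binary_tree (map_otree f t) \<longleftrightarrow> binary_tree t"
proof
  show "binary_tree t \<Longrightarrow> binary_tree (map_otree f t)"
    by (induction rule: binary_tree.induct) auto
  show "binary_tree (map_otree f t) \<Longrightarrow> binary_tree t"
  proof (induction t)
    case (ONode ts)
    from ONode.prems obtain l r where "map (map_otree f) ts = [l, r]" "binary_tree l" "binary_tree r"
      by (auto elim: binary_tree.cases)
    with ONode.IH show ?case by (auto simp: map_eq_Cons_conv)
  qed auto
qed

lemma ex_labelling:
  fixes t :: "unit otree"
  assumes "binary_tree t" "length xs = length (leaves t)"
  shows "\<exists>s. map_otree (\<lambda>_. ()) s = t \<and> leaves s = xs"
  using assms
proof (induction arbitrary: xs rule: binary_tree.induct)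
  case (binary_leaf x)
  then obtain y where "xs = [y]" by (auto simp: length_Suc_conv)
  then show ?case by (intro exI[of _ "OLeaf y"]) auto
next
  case (binary_node l r)
  let ?k = "length (leaves l)"
  have "\<exists>s. map_otree (\<lambda>_. ()) s = l \<and> leaves s = take ?k xs"
    "\<exists>s. map_otree (\<lambda>_. ()) s = r \<and> leaves s = drop ?k xs"
    using binary_node.prems by (intro binary_node.IH; simp)+
  then obtain s s' where "map_otree (\<lambda>_. ()) s = l" "leaves s = take ?k xs"
    "map_otree (\<lambda>_. ()) s' = r" "leaves s' = drop ?k xs" by blast
  then show ?case by (intro exI[of _ "ONode [s, s']"]) auto
qed

lemma labelling_unique:
  assumes "binary_tree s" "map_otree (\<lambda>_. ()) s = map_otree (\<lambda>_. ()) s'" "leaves s = leaves s'"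
  shows "s = s'"
  using assms
proof (induction arbitrary: s' rule: binary_tree.induct)
  case (binary_leaf x)
  then show ?case by (cases s') auto
next
  case (binary_node l r)
  from binary_node.prems obtain l' r' where s': "s' = ONode [l', r']"
    "map_otree (\<lambda>_. ()) l = map_otree (\<lambda>_. ()) l'" "map_otree (\<lambda>_. ()) r = map_otree (\<lambda>_. ()) r'"
    by (cases s') (auto simp: Cons_eq_map_conv)
  from arg_cong[OF s'(2), of "\<lambda>t. length (leaves t)"] have "length (leaves l) = length (leaves l')"
    by (simp add: leaves_map_otree)
  with binary_node s' show ?case by auto
qed

text \<open>
  Reading off the leaves from left to right turns the labellings of a fixed shape into the
  permutations of the label set.
\<close>

lemma card_labellings:
  assumes "t \<in> shapes n"
  shows "card (labellings n t) = fact n"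
proof -
  have "bij_betw leaves (labellings n t) (permutations_of_set {1..n})"
  proof (intro bij_betwI')
    fix s s' assume "s \<in> labellings n t" "s' \<in> labellings n t"
    then have "map_otree (\<lambda>_. ()) s = t" "map_otree (\<lambda>_. ()) s = map_otree (\<lambda>_. ()) s'"
      by (simp_all add: labellings_def)
    moreover from this(1) have "binary_tree s"
      using assms binary_tree_map_otree[of "\<lambda>_. ()" s] by (simp add: shapes_def)
    ultimately show "leaves s = leaves s' \<longleftrightarrow> s = s'"
      using labelling_unique[of s s'] by blast
  next
    fix xs assume "xs \<in> permutations_of_set {1..n}"
    then have xs: "set xs = {1..n}" "distinct xs" by (auto simp: permutations_of_set_def)
    then have "length xs = n" using distinct_card[of xs] by simp
    with ex_labelling[of t xs] assms obtain s where "map_otree (\<lambda>_. ()) s = t" "leaves s = xs"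
      by (auto simp: shapes_def)
    with xs show "\<exists>s\<in>labellings n t. xs = leaves s" by (auto simp: labellings_def)
  qed (auto simp: labellings_def permutations_of_set_def)
  then show ?thesis by (auto dest: bij_betw_same_card)
qed

lemma UN_labellings: "(\<Union>t\<in>shapes n. labellings n t) = binary_trees {1..n}"
proof (intro equalityI subsetI)
  fix s assume "s \<in> binary_trees {1..n}"
  then have s: "binary_tree s" "distinct (leaves s)" "set (leaves s) = {1..n}"
    by (simp_all add: binary_trees_def)
  from distinct_card[OF s(2)] s(3) have "length (leaves s) = n" by simp
  with s(1) have "map_otree (\<lambda>_. ()) s \<in> shapes n"
    by (simp add: shapes_def binary_tree_map_otree leaves_map_otree)
  with s show "s \<in> (\<Union>t\<in>shapes n. labellings n t)" by (simp add: labellings_def)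
next
  fix s assume "s \<in> (\<Union>t\<in>shapes n. labellings n t)"
  then show "s \<in> binary_trees {1..n}"
    by (auto simp: labellings_def shapes_def binary_trees_def binary_tree_map_otree)
qed

lemma finite_shapes: "finite (shapes n)" and shapes_nonempty: "n \<ge> 1 \<Longrightarrow> shapes n \<noteq> {}"
proof -
  have eq: "shapes n = map_otree (\<lambda>_. ()) ` binary_trees {1..n}"
  proof (intro equalityI subsetI)
    fix t assume "t \<in> shapes n"
    then have "card (labellings n t) = fact n" by (rule card_labellings)
    then have "labellings n t \<noteq> {}" by auto
    then obtain s where "s \<in> labellings n t" by blast
    with \<open>t \<in> shapes n\<close> show "t \<in> map_otree (\<lambda>_. ()) ` binary_trees {1..n}"
      unfolding UN_labellings[symmetric] by (auto simp: labellings_def intro!: image_eqI[of _ _ s])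
  next
    fix t assume "t \<in> map_otree (\<lambda>_. ()) ` binary_trees {1..n}"
    then show "t \<in> shapes n"
      unfolding UN_labellings[symmetric] by (auto simp: labellings_def)
  qed
  show "n \<ge> 1 \<Longrightarrow> shapes n \<noteq> {}"
    using binary_trees_finite_nonempty[of "{1..n}"] by (auto simp: eq)
  show "finite (shapes n)"
  proof (cases "n = 0")
    case True
    then have "shapes n = {}" using leaves_binary_nonempty by (auto simp: shapes_def)
    then show ?thesis by simp
  next
    case False
    then show ?thesis using binary_trees_finite_nonempty[of "{1..n}"] by (auto simp: eq)
  qed
qed

text \<open>
  The event also contains sample points whose family tree is not binary; these form a null set, up
  to which the event is a finite disjoint union over the binary shapes.
\<close>

lemma emeasure_terminates_with_leaves:
  "emeasure (gw_space binary_offspring) (terminates_with_leaves n)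
     = ennreal (real (card (shapes n)) * (1 / 2) ^ (2 * n - 1))"
proof -
  let ?G = "gw_space binary_offspring" and ?A = "\<lambda>t. {\<omega>. gw_subtree \<omega> [] t}"
  have "emeasure ?G (terminates_with_leaves n) = emeasure ?G (\<Union>t\<in>shapes n. ?A t)"
  proof (rule emeasure_eq_AE)
    show "AE \<omega> in ?G. \<omega> \<in> terminates_with_leaves n \<longleftrightarrow> \<omega> \<in> (\<Union>t\<in>shapes n. ?A t)"
      using AE_binary_offspring
      by eventually_elim (auto simp: terminates_with_leaves_def shapes_def intro: gw_subtree_imp_binary)
    show "(\<Union>t\<in>shapes n. ?A t) \<in> sets ?G"
      using sets_gw_subtree by (intro sets.finite_UN finite_shapes) auto
  qed (rule sets_terminates_with_leaves)
  also have "\<dots> = (\<Sum>t\<in>shapes n. emeasure ?G (?A t))"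
    using sets_gw_subtree
    by (intro sum_emeasure[symmetric] finite_shapes)
       (auto simp: disjoint_family_on_def dest: gw_subtree_unique)
  also have "\<dots> = (\<Sum>t\<in>shapes n. ennreal ((1 / 2) ^ (2 * n - 1)))"
    by (intro sum.cong refl) (auto simp: shapes_def emeasure_gw_subtree)
  finally show ?thesis by (simp add: ennreal_mult ennreal_of_nat_eq_real_of_nat)
qed

lemma gw_conditioned_eq_uniform:
  assumes "n \<ge> 1"
  shows "gw_conditioned binary_offspring n = measure_pmf (pmf_of_set (shapes n))"
proof (rule measure_eqI_countable[where A = UNIV])
  fix t :: "unit otree"
  let ?G = "gw_space binary_offspring" and ?E = "terminates_with_leaves n" and ?c = "(1 / 2 :: real) ^ (2 * n - 1)"
  have E: "?E \<inter> terminal_tree -` {t} = {\<omega>. gw_subtree \<omega> [] t \<and> length (leaves t) = n}"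
    by (auto simp: terminates_with_leaves_def dest: terminal_tree_eq)
  have "emeasure ?G {\<omega>. gw_subtree \<omega> [] t \<and> length (leaves t) = n} = ennreal (indicator (shapes n) t * ?c)"
  proof (cases "t \<in> shapes n")
    case True
    then show ?thesis using emeasure_gw_subtree[of t] by (simp add: shapes_def)
  next
    case False
    have "AE \<omega> in ?G. \<not> (gw_subtree \<omega> [] t \<and> length (leaves t) = n)"
      using AE_binary_offspring
      by eventually_elim (use False in \<open>auto simp: shapes_def dest: gw_subtree_imp_binary\<close>)
    from emeasure_eq_0_AE[OF this] show ?thesis using False by simp
  qed
  moreover have "terminal_tree -` {t} \<in> sets ?G"
    using measurable_sets[OF measurable_terminal_tree[of binary_offspring], of "{t}"] by simp
  moreover have "terminal_tree \<in> measurable (uniform_measure ?G ?E) (count_space UNIV)"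
    using measurable_terminal_tree by (simp cong: measurable_cong_sets)
  ultimately have "emeasure (gw_conditioned binary_offspring n) {t}
      = ennreal (indicator (shapes n) t * ?c) / ennreal (real (card (shapes n)) * ?c)"
    unfolding gw_conditioned_def
    by (simp add: emeasure_distr sets_terminates_with_leaves E emeasure_terminates_with_leaves)
  also have "\<dots> = ennreal (indicator (shapes n) t / real (card (shapes n)))"
    using finite_shapes[of n] shapes_nonempty[OF assms]
    by (subst divide_ennreal) (auto simp: card_gt_0_iff)
  also have "\<dots> = emeasure (measure_pmf (pmf_of_set (shapes n))) {t}"
    using finite_shapes[of n] shapes_nonempty[OF assms] by (simp add: emeasure_pmf_single)
  finally show "emeasure (gw_conditioned binary_offspring n) {t}
      = emeasure (measure_pmf (pmf_of_set (shapes n))) {t}" .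
qed (auto simp: gw_conditioned_def)

text \<open>
  All shapes admit the same number \<open>n!\<close> of labellings, so a uniform shape with a uniform
  labelling is a uniform labelled tree.
\<close>

lemma T_law_eq_uniform_tree:
  assumes "n \<ge> 1"
  shows "T_law n = measure_pmf (uniform_tree {1..n})"
proof -
  have "uniform_tree {1..n} = pmf_of_set (shapes n) \<bind> (\<lambda>t. pmf_of_set (labellings n t))"
    unfolding uniform_tree_def UN_labellings[symmetric]
  proof (rule pmf_of_set_UN[where n = "fact n"])
    show "finite (\<Union>t\<in>shapes n. labellings n t)"
      using assms binary_trees_finite_nonempty[of "{1..n}"] by (simp add: UN_labellings)
    show "labellings n t \<noteq> {}" if "t \<in> shapes n" for t
      using card_labellings[OF that] by auto
    show "disjoint_family_on (labellings n) (shapes n)"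
      by (auto simp: disjoint_family_on_def labellings_def)
  qed (use shapes_nonempty[OF assms] card_labellings in auto)
  then show ?thesis
    unfolding T_law_def gw_conditioned_eq_uniform[OF assms] by (simp add: measure_pmf_bind)
qed

section \<open>Agreement of two independent copies\<close>

lemma pair_measure_pmf:
  fixes P :: "'a :: countable pmf" and Q :: "'b :: countable pmf"
  shows "measure_pmf P \<Otimes>\<^sub>M measure_pmf Q = measure_pmf (pair_pmf P Q)"
proof (rule measure_eqI_countable[where A = UNIV])
  show "sets (measure_pmf P \<Otimes>\<^sub>M measure_pmf Q) = Pow UNIV"
    using sets_pair_countable[of UNIV UNIV "measure_pmf P" "measure_pmf Q"] by simp
  fix x :: "'a \<times> 'b"
  obtain a b where x: "x = (a, b)" by (cases x)
  have "emeasure (measure_pmf P \<Otimes>\<^sub>M measure_pmf Q) ({a} \<times> {b}) = ennreal (pmf P a) * ennreal (pmf Q b)"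
    by (subst measure_pmf.emeasure_pair_measure_Times) (auto simp: emeasure_pmf_single)
  then show "emeasure (measure_pmf P \<Otimes>\<^sub>M measure_pmf Q) {x} = emeasure (measure_pmf (pair_pmf P Q)) {x}"
    by (simp add: x emeasure_pmf_single pmf_pair ennreal_mult)
qed auto

lemma prob_pair_uniform_equal:
  assumes "finite B" "B \<noteq> {}"
  shows "measure (pair_pmf (pmf_of_set B) (pmf_of_set B)) {(u, u'). u = u'} = 1 / real (card B)"
proof -
  have "pair_pmf (pmf_of_set B) (pmf_of_set B) = pmf_of_set (B \<times> B)"
  proof (rule pmf_eqI)
    fix x
    show "pmf (pair_pmf (pmf_of_set B) (pmf_of_set B)) x = pmf (pmf_of_set (B \<times> B)) x"
      using assms by (cases x) (simp add: pmf_pair indicator_def)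
  qed
  moreover have "(B \<times> B) \<inter> {(u, u'). u = u'} = (\<lambda>u. (u, u)) ` B" by auto
  then have "card ((B \<times> B) \<inter> {(u, u'). u = u'}) = card B"
    by (simp add: card_image inj_on_def)
  ultimately show ?thesis
    using assms by (simp add: measure_pmf_of_set)
qed

abbreviation tree_pair :: "nat \<Rightarrow> (nat otree \<times> nat otree) pmf" where
  "tree_pair n \<equiv> pair_pmf (uniform_tree {1..n}) (uniform_tree {1..n})"

lemma two_copies_eq_tree_pair: "n \<ge> 1 \<Longrightarrow> two_copies n = measure_pmf (tree_pair n)"
  by (simp add: two_copies_def T_law_eq_uniform_tree pair_measure_pmf)

lemma induced_eq_restrict_binary_trees:
  "t \<in> binary_trees A \<Longrightarrow> S \<subseteq> A \<Longrightarrow> S \<noteq> {} \<Longrightarrow> induced S t = restrict_tree S t"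
  by (auto simp: binary_trees_def intro: induced_eq_restrict_tree)

lemma induced_in_binary_trees:
  assumes "t \<in> binary_trees A" "S \<subseteq> A" "S \<noteq> {}"
  shows "induced S t \<in> binary_trees S"
proof -
  have "meets S t" using assms by (auto simp: binary_trees_def)
  with assms restrict_tree_props[of t S] show ?thesis
    unfolding induced_eq_restrict_binary_trees[OF assms] by (auto simp: binary_trees_def)
qed

text \<open>
  By consistency the two induced trees are independent and uniform on the binary trees with
  leaf set \<open>S\<close>, so they coincide with the reciprocal of the number of such trees.
\<close>

lemma prob_agreement:
  assumes "S \<subseteq> {1..n}" "S \<noteq> {}"
  shows "measure (tree_pair n) {(t, t'). induced S t = induced S t'} = 1 / real (num_binary_trees (card S))"
proof -
  have ne: "{1..n} \<noteq> {}" and fin: "finite S" using assms by (auto intro: finite_subset)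
  have "map_pmf (induced S) (uniform_tree {1..n}) = map_pmf (restrict_tree S) (uniform_tree {1..n})"
    using assms ne
    by (intro map_pmf_cong refl induced_eq_restrict_binary_trees) (auto simp: set_pmf_uniform_tree)
  also have "\<dots> = uniform_tree S"
    using assms by (intro map_restrict_uniform_tree) auto
  finally have "map_pmf (\<lambda>(t, t'). (induced S t, induced S t')) (tree_pair n)
      = pair_pmf (uniform_tree S) (uniform_tree S)"
    by (simp add: map_pair)
  then have "measure (pair_pmf (uniform_tree S) (uniform_tree S)) {(u, u'). u = u'}
      = measure (tree_pair n) ((\<lambda>(t, t'). (induced S t, induced S t')) -` {(u, u'). u = u'})"
    by (metis measure_map_pmf)
  also have "(\<lambda>(t, t'). (induced S t, induced S t')) -` {(u, u'). u = u'} = {(t, t'). induced S t = induced S t'}"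
    by auto
  finally show ?thesis
    using prob_pair_uniform_equal[OF binary_trees_finite_nonempty[OF fin assms(2)]]
      card_binary_trees[OF fin assms(2)]
    by (simp add: uniform_tree_def)
qed

lemma expectation_num_agreements:
  assumes "1 \<le> a"
  shows "(\<integral>x. real (num_agreements n a x) \<partial>tree_pair n) = real (n choose a) / real (num_binary_trees a)"
proof -
  let ?F = "{S. S \<subseteq> {1..n} \<and> card S = a}"
  let ?D = "\<lambda>S. {(t, t'). induced S t = induced S t'} :: (nat otree \<times> nat otree) set"
  have fin: "finite ?F" by (rule finite_subset[of _ "Pow {1..n}"]) auto
  have "real (num_agreements n a x) = (\<Sum>S\<in>?F. indicator (?D S) x)" for x
  proof -
    have "num_agreements n a x = card (?F \<inter> {S. x \<in> ?D S})"
      by (cases x) (auto simp: num_agreements_def intro: arg_cong[where f = card])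
    also have "real \<dots> = (\<Sum>S\<in>?F. if x \<in> ?D S then 1 else 0)"
      using fin by (simp add: sum.If_cases)
    finally show ?thesis by (simp add: indicator_def of_bool_def)
  qed
  then have "(\<integral>x. real (num_agreements n a x) \<partial>tree_pair n) = (\<Sum>S\<in>?F. measure (tree_pair n) (?D S))"
    by (simp only:, subst Bochner_Integration.integral_sum)
       (auto intro!: measure_pmf.integrable_const_bound[where B = 1] simp: indicator_def)
  also have "\<dots> = (\<Sum>S\<in>?F. 1 / real (num_binary_trees a))"
    using assms by (intro sum.cong refl, subst prob_agreement) auto
  also have "\<dots> = real (n choose a) / real (num_binary_trees a)"
    using n_subsets[of "{1..n}" a] by simp
  finally show ?thesis .
qed

section \<open>The largest agreement\<close>

text \<open>
  Singletons always induce the same tree, so the maximum ranges over a nonempty set and is attained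
  by some agreeing leaf-set.
\<close>

lemma max_agreement_attained:
  assumes "n \<ge> 1" "t \<in> binary_trees {1..n}" "t' \<in> binary_trees {1..n}"
  shows "1 \<le> max_agreement n (t, t')" "max_agreement n (t, t') \<le> n"
    and "num_agreements n (max_agreement n (t, t')) (t, t') \<ge> 1"
proof -
  let ?A = "{S. S \<noteq> {} \<and> S \<subseteq> {1..n} \<and> induced S t = induced S t'}"
  have fin: "finite ?A" by (rule finite_subset[of _ "Pow {1..n}"]) auto
  have "induced {1} t = induced {1} t'"
    using assms induced_in_binary_trees[of t "{1..n}" "{1}"] induced_in_binary_trees[of t' "{1..n}" "{1}"]
    by (simp add: binary_trees_singleton)
  then have "{1} \<in> ?A" using assms by auto
  then have "card ` ?A \<noteq> {}" by blast
  then have "Max (card ` ?A) \<in> card ` ?A"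
    using fin by (intro Max_in finite_imageI)
  moreover have M: "max_agreement n (t, t') = Max (card ` ?A)"
    by (simp add: max_agreement_def setcompr_eq_image conj_commute)
  ultimately obtain S where S: "S \<in> ?A" "max_agreement n (t, t') = card S" by auto
  then have "finite S" by (auto intro: finite_subset)
  with S show "1 \<le> max_agreement n (t, t')" by (auto simp: Suc_le_eq card_gt_0_iff)
  show "max_agreement n (t, t') \<le> n" using S card_mono[of "{1..n}" S] by auto
  have "S \<in> {S. S \<subseteq> {1..n} \<and> card S = card S \<and> induced S t = induced S t'}" using S by auto
  moreover have "finite {R. R \<subseteq> {1..n} \<and> card R = card S \<and> induced R t = induced R t'}"
    by (rule finite_subset[of _ "Pow {1..n}"]) auto
  ultimately show "num_agreements n (max_agreement n (t, t')) (t, t') \<ge> 1"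
    using S by (auto simp: num_agreements_def Suc_le_eq card_gt_0_iff)
qed

text \<open>
  First moment method: if the maximum exceeds \<open>b\<close>, an agreeing set of some size
  \<open>k > b\<close> exists, so the sum over such \<open>k\<close> of the numbers of agreeing \<open>k\<close>-sets is at
  least 1.
\<close>

lemma prob_max_agreement_gt:
  assumes "n \<ge> 1"
  shows "measure (tree_pair n) {x. b < real (max_agreement n x)}
     \<le> (\<Sum>k\<in>{k. 1 \<le> k \<and> k \<le> n \<and> b < real k}. real (n choose k) / real (num_binary_trees k))"
proof -
  let ?K = "{k. 1 \<le> k \<and> k \<le> n \<and> b < real k}"
  have supp: "set_pmf (tree_pair n) = binary_trees {1..n} \<times> binary_trees {1..n}"
    using assms by (simp add: set_pmf_uniform_tree)
  then have fin: "finite (set_pmf (tree_pair n))"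
    using assms binary_trees_finite_nonempty[of "{1..n}"] by simp
  have finK: "finite ?K" by (rule finite_subset[of _ "{..n}"]) auto
  have "measure (tree_pair n) {x. b < real (max_agreement n x)}
      = (\<integral>x. indicator {x. b < real (max_agreement n x)} x \<partial>tree_pair n)"
    by simp
  also have "\<dots> \<le> (\<integral>x. (\<Sum>k\<in>?K. real (num_agreements n k x)) \<partial>tree_pair n)"
  proof (intro integral_mono_AE integrable_measure_pmf_finite[OF fin] AE_pmfI)
    fix x assume "x \<in> set_pmf (tree_pair n)"
    then obtain t t' where x: "x = (t, t')" "t \<in> binary_trees {1..n}" "t' \<in> binary_trees {1..n}"
      unfolding supp by auto
    note m = max_agreement_attained[OF assms x(2,3), folded x(1)]
    show "indicator {x. b < real (max_agreement n x)} x \<le> (\<Sum>k\<in>?K. real (num_agreements n k x))"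
    proof (cases "b < real (max_agreement n x)")
      case True
      then have "real (num_agreements n (max_agreement n x) x) \<le> (\<Sum>k\<in>?K. real (num_agreements n k x))"
        using m finK by (intro member_le_sum) auto
      with m(3) True show ?thesis by simp
    qed (simp add: sum_nonneg)
  qed
  also have "\<dots> = (\<Sum>k\<in>?K. (\<integral>x. real (num_agreements n k x) \<partial>tree_pair n))"
    by (intro Bochner_Integration.integral_sum integrable_measure_pmf_finite[OF fin])
  also have "\<dots> = (\<Sum>k\<in>?K. real (n choose k) / real (num_binary_trees k))"
    by (intro sum.cong refl expectation_num_agreements) auto
  finally show ?thesis .
qed

text \<open>
  The count in the form \<open>(2 k - 2)! / (k - 1)!\<close> (with \<open>k = m + 1\<close>), that is, the Catalan number
  times \<open>k!\<close>.
\<close>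

lemma num_binary_trees_fact: "num_binary_trees (Suc m) * fact m = fact (2 * m)"
proof (induction m)
  case 0
  show ?case by (simp add: num_binary_trees_def odd_dfact_def)
next
  case (Suc m)
  have "num_binary_trees (Suc (Suc m)) * fact (Suc m)
      = (4 * m + 2) * (m + 1) * (num_binary_trees (Suc m) * fact m)"
    by (simp add: num_binary_trees_Suc algebra_simps)
  also have "\<dots> = (2 * m + 2) * (2 * m + 1) * fact (2 * m)"
    unfolding Suc.IH by (simp add: algebra_simps)
  also have "\<dots> = fact (2 * Suc m)"
    by (simp add: algebra_simps)
  finally show ?case .
qed

text \<open>
  A single term of the exponential series; it supplies the lower bound
  \<open>(k / e)\<^sup>k \<le> k!\<close>.
\<close>

lemma power_div_fact_le_exp:
  fixes x :: real
  assumes "x \<ge> 0"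
  shows "x ^ k / fact k \<le> exp x"
proof -
  have "(\<Sum>i\<in>{k}. x ^ i /\<^sub>R fact i) \<le> (\<Sum>i. x ^ i /\<^sub>R fact i)"
    using assms by (intro sum_le_suminf sums_summable[OF exp_converges]) auto
  then show ?thesis
    using sums_unique[OF exp_converges[of x]] by (simp add: divide_inverse scaleR_conv_of_real mult.commute)
qed

text \<open>
  Up to the factor \<open>4 k\<close> the expectation is at most \<open>n\<^sup>k / (2 k)!\<close>, and bounding the factorial
  below shows where the constant \<open>e / 2\<close> comes from: the base of the resulting power drops
  below 1 exactly when \<open>k\<close> exceeds \<open>(e / 2) \<surd>n\<close>.
\<close>

lemma expected_agreements_le:
  assumes "k \<ge> 1"
  shows "real (n choose k) / real (num_binary_trees k) \<le> 4 * real k * ((exp 1 / 2) * sqrt (real n) / real k) ^ (2 * k)"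
proof -
  obtain m where k: "k = Suc m" using assms by (cases k) auto
  have N: "real (num_binary_trees k) * fact m = fact (2 * m)"
    using arg_cong[OF num_binary_trees_fact[of m], of real] by (simp add: k)
  have pos: "real (num_binary_trees k) > 0" using num_binary_trees_pos by simp
  have C: "real (n choose k) * fact k \<le> real n ^ k"
    using binomial_fact_pow[of n k] by (metis of_nat_fact of_nat_le_iff of_nat_mult of_nat_power)
  have fk: "fact k = real k * fact m" and f2k: "fact (2 * k) = (2 * real k) * (2 * real k - 1) * (fact (2 * m) :: real)"
    by (simp_all add: k algebra_simps)
  have "real (n choose k) / real (num_binary_trees k) = real (n choose k) * fact m / fact (2 * m)"
    using pos by (simp add: N[symmetric])
  also have "\<dots> = (real (n choose k) * fact k) * (2 * (2 * real k - 1)) / fact (2 * k)"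
    using assms unfolding fk f2k by (simp add: field_simps)
  also have "\<dots> \<le> real n ^ k * (4 * real k) / fact (2 * k)"
    using assms by (intro divide_right_mono mult_mono[OF C]) auto
  also have "\<dots> \<le> real n ^ k * (4 * real k) * (exp 1 / (2 * real k)) ^ (2 * k)"
  proof -
    have "(2 * real k) ^ (2 * k) / fact (2 * k) \<le> exp 1 ^ (2 * k)"
      using power_div_fact_le_exp[of "2 * real k" "2 * k"] exp_of_nat_mult[of "2 * k" "1 :: real"] by simp
    then have "1 / fact (2 * k) \<le> (exp 1 / (2 * real k)) ^ (2 * k)"
      using assms by (simp add: power_divide field_simps)
    from mult_left_mono[OF this, of "real n ^ k * (4 * real k)"] show ?thesis by simp
  qed
  also have "real n ^ k = sqrt (real n) ^ (2 * k)"
    by (simp add: power_mult)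
  also have "sqrt (real n) ^ (2 * k) * (4 * real k) * (exp 1 / (2 * real k)) ^ (2 * k)
      = 4 * real k * ((exp 1 / 2) * sqrt (real n) / real k) ^ (2 * k)"
    by (simp add: power_mult_distrib power_divide)
  finally show ?thesis .
qed

lemma expected_agreements_le_geometric:
  assumes "\<epsilon> > 0" "k \<ge> 1" "(1 + \<epsilon>) * (exp 1 / 2) * sqrt (real n) \<le> real k"
  shows "real (n choose k) / real (num_binary_trees k) \<le> 4 * real k * ((1 / (1 + \<epsilon>))\<^sup>2) ^ k"
proof -
  have "(exp 1 / 2) * sqrt (real n) / real k \<le> 1 / (1 + \<epsilon>)"
    using assms by (simp add: field_simps)
  then have "((exp 1 / 2) * sqrt (real n) / real k) ^ (2 * k) \<le> (1 / (1 + \<epsilon>)) ^ (2 * k)"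
    by (intro power_mono) auto
  then have "4 * real k * ((exp 1 / 2) * sqrt (real n) / real k) ^ (2 * k) \<le> 4 * real k * (1 / (1 + \<epsilon>)) ^ (2 * k)"
    by (intro mult_left_mono) auto
  with expected_agreements_le[OF assms(2), of n] show ?thesis
    by (simp add: power_mult)
qed

lemma sum_le_suminf_tail:
  fixes g :: "nat \<Rightarrow> real"
  assumes "summable g" "\<And>i. g i \<ge> 0" "finite K" "\<And>k. k \<in> K \<Longrightarrow> N \<le> k"
  shows "sum g K \<le> (\<Sum>i. g (i + N))"
proof -
  have "sum g K = (\<Sum>i\<in>(\<lambda>k. k - N) ` K. g (i + N))"
    by (intro sum.reindex_bij_witness[of _ "\<lambda>i. i + N" "\<lambda>k. k - N"]) (auto simp: assms(4))
  also have "\<dots> \<le> (\<Sum>i. g (i + N))"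
    using assms by (intro sum_le_suminf) (auto simp: summable_iff_shift)
  finally show ?thesis .
qed

text \<open>
  Above the threshold the expected numbers of agreeing \<open>k\<close>-sets are dominated by a convergent series
  that does not depend on \<open>n\<close>, while the threshold tends to infinity; so the union bound is a
  vanishing tail of that series.
\<close>

lemma prob_max_agreement_tendsto:
  assumes \<epsilon>: "\<epsilon> > 0"
  shows "(\<lambda>n. \<P>(x in two_copies n.
    real (max_agreement n x) \<le> (1 + \<epsilon>) * (exp 1 / 2) * sqrt (real n))) \<longlonglongrightarrow> 1"
proof -
  define c where "c = (1 + \<epsilon>) * (exp 1 / 2)"
  define q where "q = (1 / (1 + \<epsilon>))\<^sup>2"
  \<comment> \<open>\<open>Suc k\<close> in place of \<open>k\<close>, to match the derivative of the geometric series\<close>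
  define g where "g = (\<lambda>k. 4 * (real (Suc k) * q ^ k))"
  define N where "N = (\<lambda>n. nat \<lfloor>c * sqrt (real n)\<rfloor>)"
  have c: "c > 0" using \<epsilon> by (simp add: c_def)
  have q: "0 \<le> q" "q < 1"
    using \<epsilon> power_strict_mono[of "1 / (1 + \<epsilon>)" 1 2] by (auto simp: q_def)
  have g: "summable g" "\<And>k. g k \<ge> 0"
    using geometric_deriv_sums[of q] q unfolding g_def
    by (auto intro!: summable_mult dest: sums_summable)
  have "filterlim (\<lambda>n. c * sqrt (real n)) at_top sequentially"
    using c by (intro filterlim_tendsto_pos_mult_at_top[OF tendsto_const] filterlim_compose[OF sqrt_at_top filterlim_real_sequentially])
  then have "filterlim N at_top sequentially"
    unfolding filterlim_at_top N_def
  proof (intro allI)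
    fix Z :: nat
    assume "\<forall>Z. eventually (\<lambda>n. Z \<le> c * sqrt (real n)) sequentially"
    then have "eventually (\<lambda>n. real Z \<le> c * sqrt (real n)) sequentially" by blast
    then show "eventually (\<lambda>n. Z \<le> nat \<lfloor>c * sqrt (real n)\<rfloor>) sequentially"
      by eventually_elim (rule le_nat_floor)
  qed
  from filterlim_compose[OF suminf_exist_split2[OF g(1)] this]
  have tail: "(\<lambda>n. \<Sum>i. g (i + N n)) \<longlonglongrightarrow> 0" .
  have lower: "1 - (\<Sum>i. g (i + N n)) \<le> \<P>(x in two_copies n. real (max_agreement n x) \<le> c * sqrt (real n))"
    and upper: "\<P>(x in two_copies n. real (max_agreement n x) \<le> c * sqrt (real n)) \<le> 1"
    if n: "n \<ge> 1" for n
  proof -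
    let ?K = "{k. 1 \<le> k \<and> k \<le> n \<and> c * sqrt (real n) < real k}"
    have "measure (tree_pair n) {x. c * sqrt (real n) < real (max_agreement n x)}
        \<le> (\<Sum>k\<in>?K. real (n choose k) / real (num_binary_trees k))"
      by (rule prob_max_agreement_gt[OF n])
    also have "\<dots> \<le> sum g ?K"
    proof (intro sum_mono)
      fix k assume "k \<in> ?K"
      then have "real (n choose k) / real (num_binary_trees k) \<le> 4 * real k * q ^ k"
        unfolding q_def c_def using \<epsilon> by (intro expected_agreements_le_geometric) auto
      also have "\<dots> \<le> g k" using q by (simp add: g_def mult_right_mono)
      finally show "real (n choose k) / real (num_binary_trees k) \<le> g k" .
    qed
    also have "\<dots> \<le> (\<Sum>i. g (i + N n))"
    proof (rule sum_le_suminf_tail[OF g])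
      show "finite ?K" by (rule finite_subset[of _ "{..n}"]) auto
      show "N n \<le> k" if "k \<in> ?K" for k
        using that c unfolding N_def by (auto simp: nat_le_iff floor_le_iff)
    qed
    finally have "measure (tree_pair n) {x. c * sqrt (real n) < real (max_agreement n x)} \<le> (\<Sum>i. g (i + N n))" .
    moreover have "{x. real (max_agreement n x) \<le> c * sqrt (real n)}
        = space (tree_pair n) - {x. c * sqrt (real n) < real (max_agreement n x)}"
      by auto
    then have "measure (tree_pair n) {x. real (max_agreement n x) \<le> c * sqrt (real n)}
        = 1 - measure (tree_pair n) {x. c * sqrt (real n) < real (max_agreement n x)}"
      by (simp only:) (rule measure_pmf.prob_compl, simp)
    ultimately show "1 - (\<Sum>i. g (i + N n)) \<le> \<P>(x in two_copies n. real (max_agreement n x) \<le> c * sqrt (real n))"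
      by (simp add: two_copies_eq_tree_pair[OF n])
    show "\<P>(x in two_copies n. real (max_agreement n x) \<le> c * sqrt (real n)) \<le> 1"
      by (simp add: two_copies_eq_tree_pair[OF n])
  qed
  have "(\<lambda>n. \<P>(x in two_copies n. real (max_agreement n x) \<le> c * sqrt (real n))) \<longlonglongrightarrow> 1"
  proof (rule tendsto_sandwich)
    show "(\<lambda>n. 1 - (\<Sum>i. g (i + N n))) \<longlonglongrightarrow> 1"
      using tendsto_diff[OF tendsto_const tail, of 1] by simp
    show "eventually (\<lambda>n. 1 - (\<Sum>i. g (i + N n)) \<le> \<P>(x in two_copies n. real (max_agreement n x) \<le> c * sqrt (real n))) sequentially"
      using eventually_ge_at_top[of 1] by eventually_elim (rule lower)
    show "eventually (\<lambda>n. \<P>(x in two_copies n. real (max_agreement n x) \<le> c * sqrt (real n)) \<le> 1) sequentially"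
      using eventually_ge_at_top[of 1] by eventually_elim (rule upper)
  qed simp
  then show ?thesis by (simp add: c_def)
qed

theorem theorem3p1:
  shows "(\<forall>n a. 1 \<le> a \<longrightarrow> a \<le> n \<longrightarrow>
            (\<integral>x. real (num_agreements n a x) \<partial>two_copies n)
              = real (n choose a) * inverse (2 ^ (a - 1) * real (odd_dfact (a - 1))))
       \<and> (\<forall>n\<ge>1. (\<integral>x. real (num_agreements n 1 x) \<partial>two_copies n) = real n)
       \<and> (\<forall>n\<ge>2. (\<integral>x. real (num_agreements n 2 x) \<partial>two_copies n) = real n * (real n - 1) / 4)
       \<and> (\<forall>n\<ge>3. (\<integral>x. real (num_agreements n 3 x) \<partial>two_copies n)
              = real n * (real n - 1) * (real n - 2) / 72)
       \<and> (\<forall>\<epsilon>>0. (\<lambda>n. \<P>(x in two_copies n.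
              real (max_agreement n x) \<le> (1 + \<epsilon>) * (exp 1 / 2) * sqrt (real n)))
            \<longlonglongrightarrow> 1)"
proof -
  have E: "(\<integral>x. real (num_agreements n a x) \<partial>two_copies n) = real (n choose a) / real (num_binary_trees a)"
    if "1 \<le> a" "a \<le> n" for n a
    using that by (simp add: two_copies_eq_tree_pair expectation_num_agreements del: One_nat_def)
  have N: "num_binary_trees 1 = 1" "num_binary_trees 2 = 2" "num_binary_trees 3 = 12"
    by (simp_all add: num_binary_trees_def odd_dfact_def numeral_eq_Suc)
  have C: "real (n choose 2) = real n * (real n - 1) / 2"
    "real (n choose 3) = real n * (real n - 1) * (real n - 2) / 6" for n
    by (simp_all add: binomial_gbinomial gbinomial_prod_rev numeral_eq_Suc)
  show ?thesis
  proof (intro conjI allI impI)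
    fix n a :: nat assume "1 \<le> a" "a \<le> n"
    then show "(\<integral>x. real (num_agreements n a x) \<partial>two_copies n)
        = real (n choose a) * inverse (2 ^ (a - 1) * real (odd_dfact (a - 1)))"
      by (subst E) (auto simp: num_binary_trees_def divide_inverse)
  next
    fix n :: nat assume "n \<ge> 1"
    then show "(\<integral>x. real (num_agreements n 1 x) \<partial>two_copies n) = real n"
      by (subst E) (auto simp: N choose_one simp del: One_nat_def)
  next
    fix n :: nat assume "n \<ge> 2"
    then show "(\<integral>x. real (num_agreements n 2 x) \<partial>two_copies n) = real n * (real n - 1) / 4"
      by (subst E) (auto simp: N C)
  next
    fix n :: nat assume "n \<ge> 3"
    then show "(\<integral>x. real (num_agreements n 3 x) \<partial>two_copies n) = real n * (real n - 1) * (real n - 2) / 72"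
      by (subst E) (auto simp: N C)
  qed (rule prob_max_agreement_tendsto)
qed

end
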